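(* Let $n\ge 3$. Every ordering $\mathcal A \in \mathcal S_n$ of the matrix chain $M_1 M_2\cdots M_n$ is uniquely optimal on infinitely many instances $\boldsymbol k=(k_0,\ldots,k_n)$ of positive integers.
   Context: A matrix chain of length $n$ is a product $M_1 M_2 \cdots M_n$ where $M_i$ has size $k_{i-1}\times k_i$; an instance is a tuple $\boldsymbol k=(k_0,k_1,\ldots,k_n)$ of positive integers. $\mathcal S_n$ denotes the set of all (full) parenthesisations of $M_1\cdots M_n$ (there are $C_{n-1}$ of them); each parenthesisation is called an ordering. Each of the $n-1$ multiplications in an ordering multiplies a subproduct $(M_{a+1}\cdots M_b)$ by $(M_{b+1}\cdots M_c)$ for some $0\le a<b<c\le n$ and has cost $k_a k_b k_c$. The cost $T(\mathcal A,\boldsymbol k)$ of ordering $\mathcal A$ on instance $\boldsymbol k$ is the sum of the costs of its $n-1$ multiplications. An ordering $\mathcal A$ is uniquely optimal on $\boldsymbol k$ if $T(\mathcal A,\boldsymbol k) < T(\mathcal B,\boldsymbol k)$ for every $\mathcal B\in\mathcal S_n\setminus\{\mathcal A\}$. *)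

theory Defs
  imports Main
begin

text \<open>A parenthesisation of a chain of \<open>n\<close> matrices is a full binary tree with \<open>n\<close> leaves.
  The leaves carry no labels: read from left to right they are the consecutive matrices
  of the chain, so a subtree is located by the number \<open>a\<close> of matrices to its left.\<close>

datatype parenthesisation = Mat | Mul parenthesisation parenthesisation

fun num_mats :: "parenthesisation \<Rightarrow> nat" where
  "num_mats Mat = 1"
| "num_mats (Mul A B) = num_mats A + num_mats B"

definition orderings :: "nat \<Rightarrow> parenthesisation set" where
  "orderings n = {A. num_mats A = n}"

text \<open>\<open>mults a A\<close> lists the multiplications performed by \<open>A\<close>, parenthesising the part of the
  chain that starts at matrix \<open>a + 1\<close>. A triple \<open>(a, b, c)\<close> stands for the
  multiplication of the subproduct of matrices \<open>a + 1, ..., b\<close> by that of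
  matrices \<open>b + 1, ..., c\<close>.\<close>

fun mults :: "nat \<Rightarrow> parenthesisation \<Rightarrow> (nat \<times> nat \<times> nat) list" where
  "mults a Mat = []"
| "mults a (Mul A B) =
     (let b = a + num_mats A; c = b + num_mats B
      in (a, b, c) # mults a A @ mults b B)"

definition cost :: "parenthesisation \<Rightarrow> nat list \<Rightarrow> nat" where
  "cost A k = (\<Sum>(a, b, c) \<leftarrow> mults 0 A. k ! a * k ! b * k ! c)"

text \<open>\<open>k ! i\<close> is the dimension \<open>k\<^sub>i\<close>: matrix \<open>i\<close> (for \<open>1 \<le> i \<le> n\<close>) has size
  \<open>k ! (i - 1)\<close> by \<open>k ! i\<close>.\<close>

definition instances :: "nat \<Rightarrow> nat list set" where
  "instances n = {k. length k = n + 1 \<and> (\<forall>i\<le>n. k ! i > 0)}"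

definition uniquely_optimal :: "nat \<Rightarrow> parenthesisation \<Rightarrow> nat list \<Rightarrow> bool" where
  "uniquely_optimal n A k \<longleftrightarrow> (\<forall>B \<in> orderings n - {A}. cost A k < cost B k)"

lemma num_mats_pos: "num_mats A > 0"
  by (induction A) auto

lemma length_mults: "length (mults a A) = num_mats A - 1"
proof (induction A arbitrary: a)
  case (Mul A B)
  then show ?case using num_mats_pos[of A] num_mats_pos[of B] by (simp add: Let_def)
qed simp

lemma mults_bounds:
  "(x, y, z) \<in> set (mults a A) \<Longrightarrow> a \<le> x \<and> x < y \<and> y < z \<and> z \<le> a + num_mats A"
proof (induction A arbitrary: a)
  case (Mul A B)
  then show ?case using num_mats_pos[of A] num_mats_pos[of B]
    by (fastforce simp: Let_def)
qed simp

end

theory Submission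
  imports Defs
begin

text \<open>View orderings as triangulations of the polygon with vertices \<open>0, ..., n\<close>, a multiplication
  \<open>(a, b, c)\<close> being a triangle. On \<open>k\<^sub>i = K + u\<^sub>i\<close> with \<open>K\<close> large, all orderings agree to
  order \<open>K\<^sup>3\<close>, and the coefficient of \<open>K\<^sup>2\<close> is the linear cost
  \<open>\<Sum> (u\<^sub>a + u\<^sub>b + u\<^sub>c)\<close>, in which \<open>u\<^sub>i\<close> is counted once for each triangle at vertex
  \<open>i\<close>. It therefore suffices to make the linear cost uniquely minimal at the given triangulation.
  Cut off an ear, i.e. a vertex lying in only one triangle, choose weights for the smaller polygon
  by induction, and give the ear a weight exceeding all else: a triangulation that lacks this ear
  pays for its vertex at least twice.\<close>

definition linear_cost :: "nat \<Rightarrow> parenthesisation \<Rightarrow> (nat \<Rightarrow> nat) \<Rightarrow> nat" where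
  "linear_cost a A u = (\<Sum>(x, y, z) \<leftarrow> mults a A. u x + u y + u z)"

lemma linear_cost_simps [simp]:
  "linear_cost a Mat u = 0"
  "linear_cost a (Mul A B) u =
     u a + u (a + num_mats A) + u (a + num_mats A + num_mats B)
     + linear_cost a A u + linear_cost (a + num_mats A) B u"
  by (simp_all add: linear_cost_def Let_def)

lemma linear_cost_cong:
  assumes "\<And>i. a \<le> i \<Longrightarrow> i \<le> a + num_mats A \<Longrightarrow> u i = w i"
  shows "linear_cost a A u = linear_cost a A w"
  using assms by (induction A arbitrary: a) auto

lemma linear_cost_Suc: "linear_cost (Suc a) A u = linear_cost a A (\<lambda>i. u (Suc i))"
  by (induction A arbitrary: a) simp_all

text \<open>In the polygon this glues an ear onto the side from \<open>j\<close> to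
  \<open>j + 1\<close>: its tip becomes vertex \<open>Suc j\<close>, and the later vertices move up
  by one.\<close>

fun expand :: "nat \<Rightarrow> parenthesisation \<Rightarrow> parenthesisation" where
  "expand j Mat = Mul Mat Mat"
| "expand j (Mul A B) =
     (if j < num_mats A then Mul (expand j A) B else Mul A (expand (j - num_mats A) B))"

lemma num_mats_expand [simp]: "num_mats (expand j A) = Suc (num_mats A)"
  by (induction A arbitrary: j) auto

text \<open>Descending into a factor that is not a leaf ends at a node with two leaves, which is an
  ear.\<close>

lemma expand_exists:
  "A \<noteq> Mat \<Longrightarrow> \<exists>j B. A = expand j B \<and> j < num_mats B"
proof (induction A)
  case (Mul A B)
  consider (leaves) "A = Mat" "B = Mat" | (left) "A \<noteq> Mat" | (right) "B \<noteq> Mat" by blast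
  then show ?case
  proof cases
    case leaves
    then have "Mul A B = expand 0 Mat \<and> 0 < num_mats Mat" by simp
    then show ?thesis by blast
  next
    case left
    then obtain j C where "A = expand j C" "j < num_mats C" using Mul.IH by blast
    then have "Mul A B = expand j (Mul C B) \<and> j < num_mats (Mul C B)" by simp
    then show ?thesis by blast
  next
    case right
    then obtain j C where "B = expand j C" "j < num_mats C" using Mul.IH by blast
    then have "Mul A B = expand (num_mats A + j) (Mul A C) \<and> num_mats A + j < num_mats (Mul A C)"
      by simp
    then show ?thesis by blast
  qed
qed simp

text \<open>The lambda is \<open>u\<close> with the tip's weight deleted, so it weighs the polygon
  left after cutting off the ear; the other three terms are the ear's triangle.\<close>

lemma linear_cost_expand:
  "j < num_mats A \<Longrightarrow> linear_cost a (expand j A) u =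
     linear_cost a A (\<lambda>i. if i \<le> a + j then u i else u (Suc i))
     + u (a + j) + u (Suc (a + j)) + u (Suc (Suc (a + j)))"
proof (induction A arbitrary: a j)
  case (Mul A B)
  let ?w = "\<lambda>i. if i \<le> a + j then u i else u (Suc i)"
  show ?case
  proof (cases "j < num_mats A")
    case True
    \<comment> \<open>All vertices of \<open>B\<close> come after the tip, so each is
      renumbered.\<close>
    then have "linear_cost (Suc (a + num_mats A)) B u = linear_cost (a + num_mats A) B ?w"
      unfolding linear_cost_Suc by (intro linear_cost_cong) auto
    then show ?thesis using True num_mats_pos[of B] Mul.IH(1)[OF True, of a] by simp
  next
    case False
    then have "linear_cost a A u = linear_cost a A ?w"
      by (intro linear_cost_cong) auto
    then show ?thesis
      using False Mul.prems Mul.IH(2)[of "j - num_mats A" "a + num_mats A"] by simp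
  qed
qed simp

text \<open>Induction follows the tip \<open>Suc (a + j)\<close> down the tree until it is the point
  where a product is split.\<close>

lemma ear_or_expensive:
  assumes "j + 1 < num_mats A"
  shows "2 * u (Suc (a + j)) \<le> linear_cost a A u \<or> (\<exists>B. A = expand j B)"
  using assms
proof (induction A arbitrary: a j)
  case (Mul A B)
  consider (left) "j + 1 < num_mats A" | (root) "j + 1 = num_mats A" | (right) "num_mats A \<le> j"
    by linarith
  then show ?case
  proof cases
    case left
    from Mul.IH(1)[OF left, of a] show ?thesis
    proof
      assume "\<exists>C. A = expand j C"
      then obtain C where "A = expand j C" by blast
      then have "Mul A B = expand j (Mul C B)" using left by simp
      then show ?thesis by blast
    qed simp
  next
    case right
    then obtain i where j: "j = num_mats A + i" using le_Suc_ex by blast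
    then have "i + 1 < num_mats B" using Mul.prems by simp
    from Mul.IH(2)[OF this, of "a + num_mats A"] show ?thesis
    proof
      assume "\<exists>C. B = expand i C"
      then obtain C where "B = expand i C" by blast
      then have "Mul A B = expand j (Mul A C)" using j by simp
      then show ?thesis by blast
    qed (simp add: j add.assoc)
  next
    case root
    then have v: "Suc (a + j) = a + num_mats A" by simp
    show ?thesis
    proof (cases "A = Mat \<and> B = Mat")
      case True
      then have "Mul A B = expand j Mat" by simp
      then show ?thesis by blast
    next
      case False
      then consider C D where "A = Mul C D" | C D where "B = Mul C D"
        by (meson parenthesisation.exhaust)
      \<comment> \<open>The split vertex ends \<open>A\<close> and begins \<open>B\<close>, so the
        top triangle of a factor that is not a leaf contains it, in addition to the root
        triangle.\<close>
      then have "u (a + num_mats A) \<le> linear_cost a A u + linear_cost (a + num_mats A) B u"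
        by cases (simp_all add: add.assoc)
      then show ?thesis unfolding v by simp
    qed
  qed
qed simp

lemma linear_cost_unique_minimiser:
  "\<exists>u. \<forall>B. num_mats B = num_mats A \<and> B \<noteq> A \<longrightarrow> linear_cost 0 A u < linear_cost 0 B u"
proof (induction "num_mats A" arbitrary: A)
  case 0
  then show ?case using num_mats_pos[of A] by simp
next
  case (Suc m)
  show ?case
  proof (cases "A = Mat")
    case True
    have "B = Mat" if "num_mats B = 1" for B
    proof (cases B)
      case (Mul C D)
      then show ?thesis using that num_mats_pos[of C] num_mats_pos[of D] by simp
    qed
    then show ?thesis using True by auto
  next
    case False
    then obtain j A' where A: "A = expand j A'" and j: "j < num_mats A'"
      using expand_exists by blast
    have m: "num_mats A' = m" using Suc.hyps(2) A by simp
    then obtain w where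
      w: "\<And>B. num_mats B = m \<Longrightarrow> B \<noteq> A' \<Longrightarrow> linear_cost 0 A' w < linear_cost 0 B w"
      using Suc.hyps(1)[of A'] by auto
    \<comment> \<open>With this \<open>W\<close>, \<open>A\<close> costs exactly
      \<open>2 * W - 1\<close>, just below the bound for orderings lacking the ear. Deleting
      \<open>W\<close> from \<open>u\<close> gives back \<open>w\<close>.\<close>
    define W where "W = linear_cost 0 A' w + w j + w (Suc j) + 1"
    define u where "u = (\<lambda>i. if i \<le> j then w i else if i = Suc j then W else w (i - 1))"
    have "(\<lambda>i. if i \<le> 0 + j then u i else u (Suc i)) = w" by (auto simp: u_def)
    then have *: "linear_cost 0 (expand j B) u = linear_cost 0 B w + w j + W + w (Suc j)"
      if "num_mats B = m" for B
      using linear_cost_expand[of j B 0 u] that j m by (simp add: u_def)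
    have "linear_cost 0 A u < linear_cost 0 B u" if B: "num_mats B = num_mats A" "B \<noteq> A" for B
    proof (cases "\<exists>C. B = expand j C")
      case True
      then obtain C where C: "B = expand j C" by blast
      then have "num_mats C = m" "C \<noteq> A'" using B A m by auto
      then show ?thesis using w[of C] * A C m by simp
    next
      case False
      then have "2 * W \<le> linear_cost 0 B u"
        using ear_or_expensive[of j B u 0] B A j by (simp add: u_def)
      then show ?thesis using *[of A'] A m by (simp add: W_def)
    qed
    then show ?thesis by blast
  qed
qed

text \<open>What matters is that \<open>e2\<close> and \<open>e3\<close> are fixed before
  \<open>K\<close> and are nonnegative.\<close>

lemma cubic_expansion:
  fixes u :: "'a \<Rightarrow> nat"
  shows "\<exists>e2 e3 :: nat. \<forall>K. (\<Sum>(x, y, z) \<leftarrow> ts. (K + u x) * (K + u y) * (K + u z)) =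
     length ts * K ^ 3 + (\<Sum>(x, y, z) \<leftarrow> ts. u x + u y + u z) * K ^ 2 + e2 * K + e3"
proof (induction ts)
  case (Cons t ts)
  obtain x y z where t: "t = (x, y, z)" by (cases t)
  from Cons.IH obtain e2 e3 where
    "\<And>K. (\<Sum>(x, y, z) \<leftarrow> ts. (K + u x) * (K + u y) * (K + u z)) =
       length ts * K ^ 3 + (\<Sum>(x, y, z) \<leftarrow> ts. u x + u y + u z) * K ^ 2 + e2 * K + e3"
    by blast
  then have "\<forall>K. (\<Sum>(x, y, z) \<leftarrow> t # ts. (K + u x) * (K + u y) * (K + u z)) =
     length (t # ts) * K ^ 3 + (\<Sum>(x, y, z) \<leftarrow> t # ts. u x + u y + u z) * K ^ 2
     + (e2 + u x * u y + u y * u z + u x * u z) * K + (e3 + u x * u y * u z)"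
    by (simp add: t power2_eq_square power3_eq_cube algebra_simps)
  then show ?case by blast
qed simp

lemma cost_expansion:
  assumes "num_mats A = n"
  shows "\<exists>e2 e3. \<forall>K. cost A (map (\<lambda>i. K + u i) [0..<n + 1]) =
     (n - 1) * K ^ 3 + linear_cost 0 A u * K ^ 2 + e2 * K + e3"
proof -
  have "cost A (map (\<lambda>i. K + u i) [0..<n + 1]) =
      (\<Sum>(x, y, z) \<leftarrow> mults 0 A. (K + u x) * (K + u y) * (K + u z))" for K
    unfolding cost_def
  proof (intro arg_cong[where f = sum_list] map_cong refl)
    fix t assume t: "t \<in> set (mults 0 A)"
    obtain x y z where "t = (x, y, z)" by (cases t)
    moreover from this have "x < n + 1" "y < n + 1" "z < n + 1"
      using mults_bounds[of x y z 0 A] t assms by auto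
    ultimately show "(case t of (a, b, c) \<Rightarrow> map (\<lambda>i. K + u i) [0..<n + 1] ! a
        * map (\<lambda>i. K + u i) [0..<n + 1] ! b * map (\<lambda>i. K + u i) [0..<n + 1] ! c) =
        (case t of (x, y, z) \<Rightarrow> (K + u x) * (K + u y) * (K + u z))"
      by (simp del: upt_Suc)
  qed
  then show ?thesis
    using cubic_expansion[of u "mults 0 A"] assms
    by (simp add: length_mults linear_cost_def)
qed

theorem theorem4p3:
  fixes n :: nat and A :: parenthesisation
  assumes "n \<ge> 3" and "A \<in> orderings n"
  shows "infinite {k \<in> instances n. uniquely_optimal n A k}"
proof -
  have A: "num_mats A = n" using assms(2) by (simp add: orderings_def)
  obtain u where u: "\<And>B. num_mats B = n \<Longrightarrow> B \<noteq> A \<Longrightarrow> linear_cost 0 A u < linear_cost 0 B u"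
    using linear_cost_unique_minimiser[of A] A by auto
  define k where "k = (\<lambda>K. map (\<lambda>i. K + u i) [0..<n + 1])"
  obtain e2 e3 where
    costA: "\<And>K. cost A (k K) = (n - 1) * K ^ 3 + linear_cost 0 A u * K ^ 2 + e2 * K + e3"
    using cost_expansion[OF A, of u] unfolding k_def by blast
  \<comment> \<open>A competitor's linear cost is larger by at least 1, a gain of
    \<open>K ^ 2\<close>, which exceeds \<open>e2 * K + e3\<close>. Its own lower-order terms are
    dropped, so the threshold depends on \<open>A\<close> alone and serves all competitors.\<close>
  have "k K \<in> {k \<in> instances n. uniquely_optimal n A k}" if K: "K > e2 + e3" for K
  proof -
    have "cost A (k K) < cost B (k K)" if "num_mats B = n" "B \<noteq> A" for B
    proof -
      have "e3 \<le> e3 * K" using K by (cases K) auto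
      then have "e2 * K + e3 \<le> (e2 + e3) * K" by (simp add: add_mult_distrib)
      also have "\<dots> < K ^ 2" using K by (simp add: power2_eq_square)
      finally have "cost A (k K) < (n - 1) * K ^ 3 + Suc (linear_cost 0 A u) * K ^ 2"
        unfolding costA by simp
      also have "\<dots> \<le> (n - 1) * K ^ 3 + linear_cost 0 B u * K ^ 2"
        using u[OF that] by (intro add_left_mono mult_right_mono) auto
      also have "\<dots> \<le> cost B (k K)"
        using cost_expansion[OF that(1), of u] unfolding k_def by fastforce
      finally show ?thesis .
    qed
    moreover have "k K \<in> instances n"
      using K unfolding instances_def k_def by (simp del: upt_Suc)
    ultimately show ?thesis by (simp add: uniquely_optimal_def orderings_def)
  qed
  then have "k ` {e2 + e3<..} \<subseteq> {k \<in> instances n. uniquely_optimal n A k}" by auto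
  moreover have "inj k"
  proof (rule injI)
    fix K L assume "k K = k L"
    then have "k K ! 0 = k L ! 0" by simp
    then show "K = L" by (simp add: k_def del: upt_Suc)
  qed
  then have "infinite (k ` {e2 + e3<..})"
    by (metis finite_imageD infinite_Ioi inj_on_subset subset_UNIV)
  ultimately show ?thesis using infinite_super by blast
qed

end
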